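(* Let $(X,T)$ be a topological dynamical system. If $(X,T)$ is weakly mean equicontinuous, then it is $f$-weakly mean equicontinuous for every $f\in C(X)$.
   Context: A topological dynamical system $(X,T)$ consists of a nonempty compact metric space $X$ with metric $d$ and a continuous map $T:X\to X$. $C(X)$ is the set of continuous real-valued functions on $X$. $S_n$ denotes the group of permutations of $\{1,\dots,n\}$. $(X,T)$ is weakly mean equicontinuous if for every $\varepsilon>0$ there is $\delta>0$ such that $d(x,y)<\delta$ implies $\limsup_{n\to\infty}\inf_{\sigma\in S_n}\frac1n\sum_{k=1}^n d(T^kx,T^{\sigma(k)}y)<\varepsilon$. For $f\in C(X)$ put $d_f(x,y)=\limsup_{n\to\infty}\inf_{\sigma\in S_n}\frac1n\sum_{i=1}^n|f(T^ix)-f(T^{\sigma(i)}y)|$. A point $x\in X$ is an $f$-weakly mean equicontinuity point if for every $\varepsilon>0$ there exists $\delta>0$ such that $d(x,y)<\delta$ implies $d_f(x,y)<\varepsilon$. $(X,T)$ is $f$-weakly mean equicontinuous if all $x\in X$ are $f$-weakly mean equicontinuity points. *)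

theory Defs
  imports "HOL-Analysis.Analysis"
begin

text \<open>
  The space is a subset \<open>X\<close> of a metric space type, with the restricted metric, so that \<open>X\<close> may be
  any nonempty compact metric space.  Only the restrictions of \<open>T\<close> and \<open>f\<close> to \<open>X\<close> matter.
\<close>

definition topological_dynamical_system :: "'a::metric_space set \<Rightarrow> ('a \<Rightarrow> 'a) \<Rightarrow> bool" where
  "topological_dynamical_system X T \<longleftrightarrow>
     X \<noteq> {} \<and> compact X \<and> continuous_on X T \<and> T \<in> X \<rightarrow> X"

text \<open>
  The infima below are taken in the reals over a finite nonempty set (the permutations of
  \<open>{1..n}\<close>), so they are genuine minima.  The upper limits are taken in the extended reals.  For
  \<open>x, y \<in> X\<close> they are finite and agree with the real ones, the averages being bounded by
  compactness.  The term at \<open>n = 0\<close> is \<open>0\<close> and does not affect the upper limit.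
\<close>

definition weak_mean_dist :: "('a::metric_space \<Rightarrow> 'a) \<Rightarrow> 'a \<Rightarrow> 'a \<Rightarrow> ereal" where
  "weak_mean_dist T x y =
     limsup (\<lambda>n. ereal (INF \<sigma>\<in>{\<sigma>. \<sigma> permutes {1..n}}.
       (1 / real n) * (\<Sum>k=1..n. dist ((T ^^ k) x) ((T ^^ \<sigma> k) y))))"

definition weakly_mean_equicontinuous :: "'a::metric_space set \<Rightarrow> ('a \<Rightarrow> 'a) \<Rightarrow> bool" where
  "weakly_mean_equicontinuous X T \<longleftrightarrow>
     (\<forall>\<epsilon>>0. \<exists>\<delta>>0. \<forall>x\<in>X. \<forall>y\<in>X. dist x y < \<delta> \<longrightarrow> weak_mean_dist T x y < ereal \<epsilon>)"

definition f_weak_mean_dist :: "('a \<Rightarrow> real) \<Rightarrow> ('a \<Rightarrow> 'a) \<Rightarrow> 'a \<Rightarrow> 'a \<Rightarrow> ereal" where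
  "f_weak_mean_dist f T x y =
     limsup (\<lambda>n. ereal (INF \<sigma>\<in>{\<sigma>. \<sigma> permutes {1..n}}.
       (1 / real n) * (\<Sum>i=1..n. \<bar>f ((T ^^ i) x) - f ((T ^^ \<sigma> i) y)\<bar>)))"

definition f_weakly_mean_equicontinuity_point ::
    "('a::metric_space \<Rightarrow> real) \<Rightarrow> 'a set \<Rightarrow> ('a \<Rightarrow> 'a) \<Rightarrow> 'a \<Rightarrow> bool" where
  "f_weakly_mean_equicontinuity_point f X T x \<longleftrightarrow>
     x \<in> X \<and>
     (\<forall>\<epsilon>>0. \<exists>\<delta>>0. \<forall>y\<in>X. dist x y < \<delta> \<longrightarrow> f_weak_mean_dist f T x y < ereal \<epsilon>)"

definition f_weakly_mean_equicontinuous ::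
    "('a::metric_space \<Rightarrow> real) \<Rightarrow> 'a set \<Rightarrow> ('a \<Rightarrow> 'a) \<Rightarrow> bool" where
  "f_weakly_mean_equicontinuous f X T \<longleftrightarrow>
     (\<forall>x\<in>X. f_weakly_mean_equicontinuity_point f X T x)"

end

theory Submission
  imports Defs
begin

text \<open>
  On a compact space a continuous function \<open>f\<close> is Lipschitz up to an arbitrarily small additive
  error: \<open>\<bar>f u - f v\<bar> \<le> \<eta> + C * dist u v\<close> (\<open>continuous_almost_lipschitz\<close>).  Indeed, nearby points are
  covered by uniform continuity, and for points a definite distance apart the bounded oscillation
  of \<open>f\<close> is at most a multiple of that distance.  An affine bound of this kind survives averaging
  along any fixed matching of the two orbits.  So a matching that makes the average distance small
  also makes the average oscillation of \<open>f\<close> small (\<open>min_mean_mono_affine\<close>), and a \<open>\<delta>\<close> that works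
  for the metric with \<open>\<epsilon> / (4 * C)\<close> in place of \<open>\<epsilon>\<close> works for \<open>f\<close> with \<open>\<epsilon>\<close>.
\<close>

lemma continuous_almost_lipschitz:
  fixes f :: "'a::metric_space \<Rightarrow> real"
  assumes "compact X" and "continuous_on X f" and "\<eta> > 0"
  obtains C where "C > 0" and "\<And>u v. u \<in> X \<Longrightarrow> v \<in> X \<Longrightarrow> \<bar>f u - f v\<bar> \<le> \<eta> + C * dist u v"
proof -
  have "uniformly_continuous_on X f"
    using assms(1,2) by (simp add: compact_uniformly_continuous)
  then obtain d where d: "d > 0"
    and near: "\<And>u v. u \<in> X \<Longrightarrow> v \<in> X \<Longrightarrow> dist v u < d \<Longrightarrow> dist (f v) (f u) < \<eta>"
    using \<open>\<eta> > 0\<close> unfolding uniformly_continuous_on_def by metis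
  have "bounded (f ` X)"
    using assms(1,2) by (simp add: compact_continuous_image compact_imp_bounded)
  then obtain M where M: "M > 0" and bound: "\<And>u. u \<in> X \<Longrightarrow> \<bar>f u\<bar> \<le> M"
    unfolding bounded_pos by auto
  show thesis
  proof
    \<comment> \<open>The oscillation of \<open>f\<close> is at most \<open>2 * M\<close>; this slope reaches that value at distance \<open>d\<close>.\<close>
    show "2 * M / d > 0" using d M by simp
    fix u v assume uv: "u \<in> X" "v \<in> X"
    show "\<bar>f u - f v\<bar> \<le> \<eta> + 2 * M / d * dist u v"
    proof (cases "dist u v < d")
      case True
      then have "\<bar>f u - f v\<bar> < \<eta>" using near[OF uv(2,1)] by (simp add: dist_real_def)
      moreover have "0 \<le> 2 * M / d * dist u v" using d M by simp
      ultimately show ?thesis by linarith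
    next
      case False
      then have "2 * M / d * d \<le> 2 * M / d * dist u v"
        using d M by (intro mult_left_mono) auto
      then have "2 * M \<le> 2 * M / d * dist u v" using d by simp
      then show ?thesis using bound[OF uv(1)] bound[OF uv(2)] \<open>\<eta> > 0\<close> by linarith
    qed
  qed
qed

text \<open>
  Any matching \<open>\<sigma>\<close> witnessing that the minimal \<open>a\<close>-average is below \<open>e\<close> serves as a competitor for
  the minimal \<open>b\<close>-average.
\<close>

lemma min_mean_mono_affine:
  fixes a b :: "nat \<Rightarrow> nat \<Rightarrow> real"
  assumes "\<eta> \<ge> 0" and "C \<ge> 0" and le: "\<And>i j. b i j \<le> \<eta> + C * a i j"
    and less: "(INF \<sigma>\<in>{\<sigma>. \<sigma> permutes {1..n}}. (1 / real n) * (\<Sum>k=1..n. a k (\<sigma> k))) < e"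
  shows "(INF \<sigma>\<in>{\<sigma>. \<sigma> permutes {1..n}}. (1 / real n) * (\<Sum>k=1..n. b k (\<sigma> k))) \<le> \<eta> + C * e"
proof -
  let ?P = "{\<sigma>. \<sigma> permutes {1..n}}"
  have fin: "finite ?P" by (simp add: finite_permutations)
  have "?P \<noteq> {}" using permutes_id by blast
  then obtain \<sigma> where \<sigma>: "\<sigma> \<in> ?P" and small: "(1 / real n) * (\<Sum>k=1..n. a k (\<sigma> k)) < e"
    using less fin by (subst (asm) cINF_less_iff) auto
  have "(INF \<sigma>\<in>?P. (1 / real n) * (\<Sum>k=1..n. b k (\<sigma> k))) \<le> (1 / real n) * (\<Sum>k=1..n. b k (\<sigma> k))"
    using fin \<sigma> by (intro cINF_lower) auto
  also have "\<dots> \<le> (1 / real n) * (\<Sum>k=1..n. \<eta> + C * a k (\<sigma> k))"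
    using le by (intro mult_left_mono sum_mono) auto
  also have "\<dots> = (1 / real n) * (real n * \<eta>) + C * ((1 / real n) * (\<Sum>k=1..n. a k (\<sigma> k)))"
    by (simp add: sum.distrib sum_distrib_left[symmetric] algebra_simps add_divide_distrib)
  also have "\<dots> \<le> \<eta> + C * e"
    \<comment> \<open>For \<open>n = 0\<close> the first summand is \<open>0\<close> instead of \<open>\<eta>\<close>.\<close>
    using small \<open>\<eta> \<ge> 0\<close> \<open>C \<ge> 0\<close> by (intro add_mono mult_left_mono) auto
  finally show ?thesis .
qed

lemma f_weak_mean_dist_le:
  fixes T :: "'a::metric_space \<Rightarrow> 'a"
  assumes T: "T \<in> X \<rightarrow> X" and "x \<in> X" "y \<in> X" and "\<eta> \<ge> 0" "C \<ge> 0"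
    and le: "\<And>u v. u \<in> X \<Longrightarrow> v \<in> X \<Longrightarrow> \<bar>f u - f v\<bar> \<le> \<eta> + C * dist u v"
    and less: "weak_mean_dist T x y < ereal e"
  shows "f_weak_mean_dist f T x y \<le> ereal (\<eta> + C * e)"
proof -
  have orbit: "(T ^^ k) z \<in> X" if "z \<in> X" for k z
    using that T by (induction k) auto
  have "\<bar>f ((T ^^ i) x) - f ((T ^^ j) y)\<bar> \<le> \<eta> + C * dist ((T ^^ i) x) ((T ^^ j) y)" for i j
    using le orbit \<open>x \<in> X\<close> \<open>y \<in> X\<close> by blast
  note step = min_mean_mono_affine[OF \<open>\<eta> \<ge> 0\<close> \<open>C \<ge> 0\<close> this]
  have "\<forall>\<^sub>F n in sequentially. (INF \<sigma>\<in>{\<sigma>. \<sigma> permutes {1..n}}.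
      (1 / real n) * (\<Sum>k=1..n. dist ((T ^^ k) x) ((T ^^ \<sigma> k) y))) < e"
    using Limsup_lessD[OF less[unfolded weak_mean_dist_def]] by simp
  then have "\<forall>\<^sub>F n in sequentially. (INF \<sigma>\<in>{\<sigma>. \<sigma> permutes {1..n}}.
      (1 / real n) * (\<Sum>i=1..n. \<bar>f ((T ^^ i) x) - f ((T ^^ \<sigma> i) y)\<bar>)) \<le> \<eta> + C * e"
    by (rule eventually_mono) (rule step)
  then show ?thesis
    unfolding f_weak_mean_dist_def by (intro Limsup_bounded) simp
qed

theorem theorem8p13:
  fixes X :: "'a::metric_space set" and T :: "'a \<Rightarrow> 'a"
  assumes "topological_dynamical_system X T"
    and "weakly_mean_equicontinuous X T"
  shows "\<forall>f :: 'a \<Rightarrow> real. continuous_on X f \<longrightarrow> f_weakly_mean_equicontinuous f X T"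
  unfolding f_weakly_mean_equicontinuous_def f_weakly_mean_equicontinuity_point_def
proof (intro allI impI ballI conjI)
  fix f :: "'a \<Rightarrow> real" and x and \<epsilon> :: real
  assume f: "continuous_on X f" and x: "x \<in> X" and "\<epsilon> > 0"
  have X: "compact X" and T: "T \<in> X \<rightarrow> X"
    using assms(1) by (auto simp: topological_dynamical_system_def)
  obtain C where C: "C > 0"
    and lip: "\<And>u v. u \<in> X \<Longrightarrow> v \<in> X \<Longrightarrow> \<bar>f u - f v\<bar> \<le> \<epsilon> / 4 + C * dist u v"
    using continuous_almost_lipschitz[OF X f, of "\<epsilon> / 4"] \<open>\<epsilon> > 0\<close> by auto
  have "\<epsilon> / (4 * C) > 0" using C \<open>\<epsilon> > 0\<close> by simp
  then obtain \<delta> where "\<delta> > 0" and \<delta>: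
    "\<And>x y. x \<in> X \<Longrightarrow> y \<in> X \<Longrightarrow> dist x y < \<delta> \<Longrightarrow> weak_mean_dist T x y < ereal (\<epsilon> / (4 * C))"
    using assms(2) unfolding weakly_mean_equicontinuous_def by metis
  have "f_weak_mean_dist f T x y < ereal \<epsilon>" if y: "y \<in> X" "dist x y < \<delta>" for y
  proof -
    have "f_weak_mean_dist f T x y \<le> ereal (\<epsilon> / 4 + C * (\<epsilon> / (4 * C)))"
      using f_weak_mean_dist_le[OF T x y(1) _ _ lip \<delta>[OF x y]] C \<open>\<epsilon> > 0\<close> by simp
    also have "\<dots> < ereal \<epsilon>" using C \<open>\<epsilon> > 0\<close> by simp
    finally show ?thesis .
  qed
  then show "\<exists>\<delta>>0. \<forall>y\<in>X. dist x y < \<delta> \<longrightarrow> f_weak_mean_dist f T x y < ereal \<epsilon>"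
    using \<open>\<delta> > 0\<close> by blast
qed

end
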